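(* For any $c\in W_{G_2^{(1)}}^0=\mathcal C_6^g$, we have $$L_{G_2^{(1)}}(c)=L_{A_5^{(2)}}(c)+a_3^{A_5^{(2)}}(c)=\frac12\big(L(c)-a_0(c)+a_3(c)\big).$$
   Context: A $6$-core is a partition having no hook length equal to $6$; $\mathcal C_6$ is the set of $6$-cores. The box in row $i$, column $j$ has residue $(j-i)\bmod 6$; boxes of residue $i$ are $i$-nodes; $L(c)$ is the number of boxes of $c$ and $a_i(c)$ its number of $i$-nodes. The affine Weyl group $\widetilde{\mathfrak S}_6$ of type $A_5^{(1)}$, with simple reflections $s_0,\dots,s_5$, acts on $\mathcal C_6$: $s_i\cdot c$ is obtained by removing all removable $i$-nodes of $c$ if there are some, adding all addable $i$-nodes if there are some, and $s_i\cdot c=c$ otherwise. A $6$-core $c$ is determined by the vector $\beta\in\mathbb Z^6$, $\beta_i=a_{i-1}(c)-a_{i\bmod 6}(c)$, $1\le i\le 6$. $\mathcal C_6^g$ is the set of $6$-cores whose vector is of the form $(\beta_1,\beta_2,\beta_1-\beta_2,\beta_2-\beta_1,-\beta_2,-\beta_1)$. Let $\alpha_0,\dots,\alpha_5$, $\Lambda_0,\dots,\Lambda_5$ be the simple roots and fundamental weights of type $A_5^{(1)}$, with $\widetilde{\mathfrak S}_6$ acting by $s_i(x)=x-\langle x,\alpha_i^\vee\rangle\alpha_i$. Type $A_5^{(2)}$ is realized by $\alpha_0^{A_5^{(2)}}=2\alpha_0+\alpha_1+\alpha_5$, $\alpha_1^{A_5^{(2)}}=\alpha_1+\alpha_5$,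 $\alpha_2^{A_5^{(2)}}=\alpha_2+\alpha_4$, $\alpha_3^{A_5^{(2)}}=2\alpha_3$, $\Lambda_0^{A_5^{(2)}}=\Lambda_0$, with Weyl group $\langle s_0s_1s_5s_0,\,s_1s_5,\,s_2s_4,\,s_3\rangle$. Type $G_2^{(1)}$ is realized by $\alpha_0^{G_2^{(1)}}=3\alpha_0^{A_5^{(2)}}$, $\alpha_1^{G_2^{(1)}}=3\alpha_2^{A_5^{(2)}}$, $\alpha_2^{G_2^{(1)}}=\alpha_1^{A_5^{(2)}}+\alpha_3^{A_5^{(2)}}$, $\Lambda_0^{G_2^{(1)}}=3\Lambda_0^{A_5^{(2)}}$, with Weyl group $W_{G_2^{(1)}}=\langle s_0s_1s_5s_0,\,s_2s_4,\,s_1s_3s_5\rangle$. The affine Grassmannian $W_{G_2^{(1)}}^0$ (minimal length representatives of left cosets modulo $\langle s_2s_4,s_1s_3s_5\rangle$) is identified with $\mathcal C_6^g$ via $w\mapsto w\cdot\varnothing$. For $X\in\{A_5^{(2)},G_2^{(1)}\}$ and $w$ in the Weyl group of type $X$ with $c=w\cdot\varnothing$, write $\Lambda_0^X-w(\Lambda_0^X)=\sum_i a_i^X(c)\alpha_i^X$ (this depends only on $c$); the atomic length is $L_X(c)=\sum_i a_i^X(c)$. *)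

theory Defs
  imports "HOL-Analysis.Analysis" "HOL-Library.Numeral_Type"
    "HOL-Algebra.Bij" "HOL-Algebra.Generated_Groups"
begin

text \<open>
  Throughout, the type \<open>6\<close> (the integers modulo 6) indexes residues, simple reflections, simple
  roots and fundamental weights of type \<open>A\<^sub>5\<^sup>(\<^sup>1\<^sup>)\<close>.
\<close>

section \<open>Partitions, cores and residues\<close>

text \<open>
  A partition is given by its Young diagram. Rows and columns are numbered from 0, which does not
  affect hook lengths or residues.
\<close>

type_synonym box = "nat \<times> nat"
type_synonym diagram = "box set"

definition is_partition :: "diagram \<Rightarrow> bool" where
  "is_partition c \<longleftrightarrow>
     finite c \<and> (\<forall>i j i' j'. (i, j) \<in> c \<and> i' \<le> i \<and> j' \<le> j \<longrightarrow> (i', j') \<in> c)"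

definition hook :: "diagram \<Rightarrow> box \<Rightarrow> box set" where
  "hook c b = {(i, j) \<in> c. (i = fst b \<and> snd b \<le> j) \<or> (fst b \<le> i \<and> j = snd b)}"

definition hook_length :: "diagram \<Rightarrow> box \<Rightarrow> nat" where
  "hook_length c b = card (hook c b)"

definition cores6 :: "diagram set" where
  "cores6 = {c. is_partition c \<and> (\<forall>b\<in>c. hook_length c b \<noteq> 6)}"

definition residue :: "box \<Rightarrow> 6" where
  "residue b = of_int (int (snd b) - int (fst b))"

definition nodes :: "diagram \<Rightarrow> 6 \<Rightarrow> box set" where
  "nodes c i = {b \<in> c. residue b = i}"

definition num_nodes :: "diagram \<Rightarrow> 6 \<Rightarrow> nat" where
  "num_nodes c i = card (nodes c i)"

definition num_boxes :: "diagram \<Rightarrow> nat" where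
  "num_boxes c = card c"

definition removable_nodes :: "diagram \<Rightarrow> 6 \<Rightarrow> box set" where
  "removable_nodes c i = {b. b \<in> c \<and> is_partition (c - {b}) \<and> residue b = i}"

definition addable_nodes :: "diagram \<Rightarrow> 6 \<Rightarrow> box set" where
  "addable_nodes c i = {b. b \<notin> c \<and> is_partition (insert b c) \<and> residue b = i}"

definition core_reflection :: "6 \<Rightarrow> diagram \<Rightarrow> diagram" where
  "core_reflection i c =
     (if removable_nodes c i \<noteq> {} then c - removable_nodes c i else c \<union> addable_nodes c i)"

text \<open>For \<open>i = 6\<close> the index \<open>of_nat i\<close> is \<open>0\<close>, i.e. \<open>i mod 6\<close>.\<close>

definition beta :: "diagram \<Rightarrow> nat \<Rightarrow> int" where
  "beta c i = int (num_nodes c (of_nat (i - 1))) - int (num_nodes c (of_nat i))"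

definition cores6g :: "diagram set" where
  "cores6g = {c \<in> cores6. \<exists>b1 b2.
     map (beta c) [1, 2, 3, 4, 5, 6] = [b1, b2, b1 - b2, b2 - b1, - b2, - b1]}"


section \<open>Weights of type \<open>A\<^sub>5\<^sup>(\<^sup>1\<^sup>)\<close> and the affine Weyl group\<close>

text \<open>
  The pair \<open>(x, d)\<close> stands for \<open>(\<Sum>i. x\<^sub>i \<Lambda>\<^sub>i) + d \<delta>\<close>, so that \<open>x\<^sub>i\<close> is the pairing with the
  \<open>i\<close>-th simple coroot. The coefficients of \<open>\<delta>\<close> are normalised as usual:
  \<open>\<alpha>\<^sub>0 + \<dots> + \<alpha>\<^sub>5 = \<delta>\<close>, which makes the simple roots linearly independent.
\<close>

type_synonym weight = "(real ^ 6) \<times> real"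

definition coroot_pairing :: "weight \<Rightarrow> 6 \<Rightarrow> real" where
  "coroot_pairing x i = fst x $ i"

definition cartan :: "6 \<Rightarrow> 6 \<Rightarrow> real" where
  "cartan i j = (if i = j then 2 else if i = j + 1 \<or> j = i + 1 then - 1 else 0)"

definition simple_root :: "6 \<Rightarrow> weight" where
  "simple_root j = ((\<chi> i. cartan i j), (if j = 0 then 1 else 0))"

definition fundamental_weight :: "6 \<Rightarrow> weight" where
  "fundamental_weight j = (axis j 1, 0)"

definition weight_reflection :: "6 \<Rightarrow> weight \<Rightarrow> weight" where
  "weight_reflection i x = x - coroot_pairing x i *\<^sub>R simple_root i"

text \<open>
  The affine Weyl group is taken in its faithful representation on weights: its elements are the
  compositions of simple reflections, and its subgroups are formed in the group of all bijections
  of the weight space. An element \<open>w = s\<^sub>i \<circ> s\<^sub>j \<circ> \<dots>\<close> acts on a core by applying the corresponding reflections of cores; the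
  result does not depend on the chosen expression of \<open>w\<close>.
\<close>

abbreviation generated_by :: "(weight \<Rightarrow> weight) set \<Rightarrow> (weight \<Rightarrow> weight) set" where
  "generated_by S \<equiv> generate (BijGroup UNIV) S"

definition weyl_act :: "(weight \<Rightarrow> weight) \<Rightarrow> diagram \<Rightarrow> diagram" where
  "weyl_act w c = (THE d. \<exists>u. w = foldr weight_reflection u \<and> d = foldr core_reflection u c)"


section \<open>Types \<open>A\<^sub>5\<^sup>(\<^sup>2\<^sup>)\<close> and \<open>G\<^sub>2\<^sup>(\<^sup>1\<^sup>)\<close>\<close>

abbreviation s :: "6 \<Rightarrow> weight \<Rightarrow> weight" where "s \<equiv> weight_reflection"

definition simple_root_A52 :: "4 \<Rightarrow> weight" where
  "simple_root_A52 i =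
     (if i = 0 then 2 *\<^sub>R simple_root 0 + simple_root 1 + simple_root 5
      else if i = 1 then simple_root 1 + simple_root 5
      else if i = 2 then simple_root 2 + simple_root 4
      else 2 *\<^sub>R simple_root 3)"

definition Lambda0_A52 :: weight where
  "Lambda0_A52 = fundamental_weight 0"

definition weyl_group_A52 :: "(weight \<Rightarrow> weight) set" where
  "weyl_group_A52 = generated_by {s 0 \<circ> s 1 \<circ> s 5 \<circ> s 0, s 1 \<circ> s 5, s 2 \<circ> s 4, s 3}"

definition simple_root_G21 :: "3 \<Rightarrow> weight" where
  "simple_root_G21 i =
     (if i = 0 then 3 *\<^sub>R simple_root_A52 0
      else if i = 1 then 3 *\<^sub>R simple_root_A52 2
      else simple_root_A52 1 + simple_root_A52 3)"

definition Lambda0_G21 :: weight where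
  "Lambda0_G21 = 3 *\<^sub>R Lambda0_A52"

definition weyl_group_G21 :: "(weight \<Rightarrow> weight) set" where
  "weyl_group_G21 = generated_by {s 0 \<circ> s 1 \<circ> s 5 \<circ> s 0, s 2 \<circ> s 4, s 1 \<circ> s 3 \<circ> s 5}"


section \<open>Atomic length\<close>

text \<open>
  The coefficients depend only on \<open>c\<close>, not on the choice of \<open>w\<close> with \<open>w \<cdot> \<emptyset> = c\<close>, and are
  unique because the simple roots of each type are linearly independent.
\<close>

definition root_coeffs ::
    "('i::finite \<Rightarrow> weight) \<Rightarrow> weight \<Rightarrow> (weight \<Rightarrow> weight) set \<Rightarrow> diagram \<Rightarrow> 'i \<Rightarrow> real" where
  "root_coeffs \<alpha> \<Lambda> W c =
     (THE a. \<exists>w\<in>W. weyl_act w {} = c \<and> \<Lambda> - w \<Lambda> = (\<Sum>i\<in>UNIV. a i *\<^sub>R \<alpha> i))"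

definition coeff_A52 :: "diagram \<Rightarrow> 4 \<Rightarrow> real" where
  "coeff_A52 = root_coeffs simple_root_A52 Lambda0_A52 weyl_group_A52"

definition coeff_G21 :: "diagram \<Rightarrow> 3 \<Rightarrow> real" where
  "coeff_G21 = root_coeffs simple_root_G21 Lambda0_G21 weyl_group_G21"

definition atomic_length_A52 :: "diagram \<Rightarrow> real" where
  "atomic_length_A52 c = (\<Sum>i\<in>UNIV. coeff_A52 c i)"

definition atomic_length_G21 :: "diagram \<Rightarrow> real" where
  "atomic_length_G21 c = (\<Sum>i\<in>UNIV. coeff_G21 c i)"

end

theory Submission
  imports Defs
begin

text \<open>
  All three quantities are linear functions of the numbers \<open>a\<^sub>i\<close> of \<open>i\<close>-nodes of the core \<open>c\<close>,
  because of the identity \<open>\<Lambda>\<^sub>0 - w \<Lambda>\<^sub>0 = (\<Sum>i. a\<^sub>i(c) \<alpha>\<^sub>i)\<close> for \<open>c = w \<cdot> \<emptyset>\<close>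
  (lemma \<open>weight_displacement\<close>). The vector \<open>\<beta>\<close> of a core has the shape required in
  \<open>cores6g\<close> if and only if \<open>a\<^sub>5 = a\<^sub>1\<close>, \<open>a\<^sub>4 = a\<^sub>2\<close> and \<open>a\<^sub>3 = 2 a\<^sub>1 - a\<^sub>0\<close>. Comparing coefficients in the
  roots of the two folded types gives
  \<open>(a\<^sub>0/2, a\<^sub>1 - a\<^sub>0/2, a\<^sub>2, a\<^sub>3/2)\<close> in type \<open>A\<^sub>5\<^sup>(\<^sup>2\<^sup>)\<close> and
  \<open>(a\<^sub>0/2, a\<^sub>2, 3 a\<^sub>3/2)\<close> in type \<open>G\<^sub>2\<^sup>(\<^sup>1\<^sup>)\<close>, and all three expressions become
  \<open>a\<^sub>1 + a\<^sub>2 + a\<^sub>3\<close>.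

  The identity is proved by following one simple reflection at a time. It needs that a
  reflection of a core changes its number of \<open>i\<close>-nodes by
  \<open>\<langle>w \<Lambda>\<^sub>0, \<alpha>\<^sub>i\<^sup>\<or>\<rangle>\<close> (lemma \<open>counts_core_reflection\<close>). On the abacus, a core reflection
  exchanges two neighbouring runners (with a shift if \<open>i = 0\<close>). The length of each diagonal of
  residue \<open>i\<close> changes by a second difference of lengths, plus 1 on the main diagonal,
  from which this formula follows by summation.

  The coefficients are defined through elements \<open>w\<close> of the folded Weyl groups, so two more facts
  are needed. The core \<open>w \<cdot> \<emptyset>\<close> depends only on \<open>w\<close>: this holds because the numbers of nodes
  determine a core (lemma \<open>counts_determine_core\<close>). And every core in \<open>cores6g\<close> is reached from the
  empty one by the group of type \<open>G\<^sub>2\<^sup>(\<^sup>1\<^sup>)\<close> (lemma \<open>symmetric_core_reachable\<close>). Both are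
  descents on the number of boxes: a nonempty core has a negative coroot value, so some reflection,
  respectively some generator of the folded group, makes it smaller.
\<close>

section \<open>Young diagrams and their diagonal lengths\<close>

definition box_content :: "box \<Rightarrow> int" where
  "box_content b = int (snd b) - int (fst b)"

definition diag_len :: "diagram \<Rightarrow> int \<Rightarrow> int" where
  "diag_len c d = int (card {b \<in> c. box_content b = d})"

text \<open>
  The boxes of content \<open>d\<close>, listed from the boundary of the quadrant inwards; \<open>k\<close> is the
  smaller of the two coordinates.
\<close>
definition diag_box :: "int \<Rightarrow> nat \<Rightarrow> box" where
  "diag_box d k = (nat (- d) + k, nat d + k)"

lemma box_content_diag_box [simp]: "box_content (diag_box d k) = d"
  by (simp add: box_content_def diag_box_def)

lemma diag_box_content: "diag_box (int q - int p) (min p q) = (p, q)"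
  by (auto simp: diag_box_def min_def nat_diff_distrib')

lemma inj_diag_box: "inj (diag_box d)"
  by (auto simp: inj_def diag_box_def)

lemma diag_len_conv_card: "diag_len c d = int (card {k. diag_box d k \<in> c})"
proof -
  have "b \<in> diag_box d ` {k. diag_box d k \<in> c}" if "b \<in> c" "box_content b = d" for b
  proof -
    obtain p q where b: "b = (p, q)" by (cases b)
    with that have "diag_box d (min p q) = b"
      using diag_box_content[of q p] by (simp add: box_content_def)
    with that show ?thesis by (metis image_eqI mem_Collect_eq)
  qed
  then have "{b \<in> c. box_content b = d} = diag_box d ` {k. diag_box d k \<in> c}" by auto
  then show ?thesis
    by (simp add: diag_len_def card_image[OF inj_on_subset[OF inj_diag_box]])
qed

lemma partition_empty: "is_partition {}"
  by (simp add: is_partition_def)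

text \<open>
  A partition meets each diagonal in an initial segment, because it contains the upper left
  neighbour of each of its boxes. So the diagonal lengths determine it.
\<close>
lemma partition_mem_iff:
  assumes "is_partition c"
  shows "(p, q) \<in> c \<longleftrightarrow> int (min p q) < diag_len c (int q - int p)"
proof -
  define d where "d = int q - int p"
  define K where "K = {k. diag_box d k \<in> c}"
  have "finite K"
    unfolding K_def using assms finite_vimageI[OF _ inj_diag_box, of c d]
    by (simp add: is_partition_def vimage_def)
  moreover have down: "k' \<in> K" if "k \<in> K" "k' \<le> k" for k k'
    using assms that unfolding K_def is_partition_def diag_box_def
    by (metis add_le_mono1 add.commute mem_Collect_eq)
  ultimately have "K = {..<card K}"
  proof -
    have "k < card K" if "k \<in> K" for k
    proof -
      have "{..k} \<subseteq> K" using down that by auto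
      from card_mono[OF \<open>finite K\<close> this] show ?thesis by simp
    qed
    then have "K \<subseteq> {..<card K}" by auto
    then show ?thesis by (simp add: card_subset_eq)
  qed
  moreover have "(p, q) \<in> c \<longleftrightarrow> min p q \<in> K"
    unfolding K_def d_def by (simp add: diag_box_content)
  ultimately show ?thesis
    unfolding diag_len_conv_card using K_def d_def by auto
qed

text \<open>
  The bounding path of a Young diagram leads from each diagonal to the next one by a unit step,
  which is horizontal or vertical; the step from the diagonal \<open>d\<close> to \<open>d + 1\<close> is a bead at
  position \<open>d\<close> of the abacus (or Maya diagram) if it is vertical and a gap if it is horizontal.
  In terms of the diagonal lengths \<open>n\<close> a bead is the value 1 and a gap the value 0 below. The
  correction for \<open>d < 0\<close> makes the empty diagram have beads exactly at the negative positions.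
\<close>
definition bead_of :: "(int \<Rightarrow> int) \<Rightarrow> int \<Rightarrow> int" where
  "bead_of n d = n d - n (d + 1) + (if d < 0 then 1 else 0)"

definition young_of :: "(int \<Rightarrow> int) \<Rightarrow> diagram" where
  "young_of n = {(p, q). int (min p q) < n (int q - int p)}"

text \<open>
  The functions \<open>int \<Rightarrow> int\<close> that are the diagonal lengths of a partition: each bead value must
  be 0 or 1.
\<close>
definition profile :: "(int \<Rightarrow> int) \<Rightarrow> bool" where
  "profile n \<longleftrightarrow> finite {d. n d \<noteq> 0} \<and> (\<forall>d. 0 \<le> n d) \<and> (\<forall>d. bead_of n d \<in> {0, 1})"

lemma young_of_diag_len: "is_partition c \<Longrightarrow> young_of (diag_len c) = c"
  by (auto simp: young_of_def partition_mem_iff)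

lemma diag_len_young_of:
  assumes "\<And>d. 0 \<le> n d"
  shows "diag_len (young_of n) = n"
proof
  fix d
  have "{k. diag_box d k \<in> young_of n} = {..<nat (n d)}"
    by (auto simp: diag_box_def young_of_def min_def split: if_splits)
  then show "diag_len (young_of n) d = n d"
    unfolding diag_len_conv_card using assms by simp
qed

lemma diag_len_nonneg: "0 \<le> diag_len c d"
  by (simp add: diag_len_def)

text \<open>
  If the diagonal \<open>d \<ge> 0\<close> has length \<open>n\<close> and its successor has length \<open>m\<close>, closure under
  moving one column to the left gives \<open>m \<le> n\<close>, and closure under moving one row up gives
  \<open>n \<le> m + 1\<close>. For \<open>d < 0\<close> rows and columns exchange their roles.
\<close>
lemma partition_profile:
  assumes "is_partition c"
  shows "profile (diag_len c)"
  unfolding profile_def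
proof (intro conjI allI)
  have "{d. diag_len c d \<noteq> 0} \<subseteq> box_content ` c"
    by (auto simp: diag_len_def card_eq_0_iff)
  then show "finite {d. diag_len c d \<noteq> 0}"
    using assms finite_subset by (auto simp: is_partition_def)
  show "0 \<le> diag_len c d" for d by (rule diag_len_nonneg)
  fix d
  define n m where "n = diag_len c d" and "m = diag_len c (d + 1)"
  have nm: "0 \<le> n" "0 \<le> m" by (auto simp: n_def m_def diag_len_nonneg)
  have down: "(i', j') \<in> c" if "(i, j) \<in> c" "i' \<le> i" "j' \<le> j" for i j i' j'
    using assms that unfolding is_partition_def by blast
  have memd: "int (min p q) < n" if "(p, q) \<in> c" "int q - int p = d" for p q
    using that partition_mem_iff[OF assms] by (auto simp: n_def)
  have memd': "(p, q) \<in> c" if "int (min p q) < n" "int q - int p = d" for p q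
    using that partition_mem_iff[OF assms] by (auto simp: n_def)
  have meme: "int (min p q) < m" if "(p, q) \<in> c" "int q - int p = d + 1" for p q
    using that partition_mem_iff[OF assms] by (auto simp: m_def)
  have meme': "(p, q) \<in> c" if "int (min p q) < m" "int q - int p = d + 1" for p q
    using that partition_mem_iff[OF assms] by (auto simp: m_def)
  show "bead_of (diag_len c) d \<in> {0, 1}"
  proof (cases "0 \<le> d")
    case True
    define e where "e = nat d"
    have e: "d = int e" using True by (simp add: e_def)
    have "m \<le> n"
    proof (rule ccontr)
      assume "\<not> m \<le> n"
      then have "(nat n, nat n + Suc e) \<in> c" using nm e by (intro meme') auto
      then have "(nat n, nat n + e) \<in> c" by (rule down) auto
      from memd[OF this] show False using nm e by auto
    qed
    moreover have "n \<le> m + 1"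
    proof (rule ccontr)
      assume "\<not> n \<le> m + 1"
      then have "(Suc (nat m), Suc (nat m) + e) \<in> c" using nm e by (intro memd') auto
      then have "(nat m, nat m + Suc e) \<in> c" by (rule down) auto
      from meme[OF this] show False using nm e by auto
    qed
    ultimately show ?thesis using True by (auto simp: bead_of_def n_def m_def)
  next
    case False
    define e where "e = nat (- d - 1)"
    have e: "d = - int e - 1" using False by (simp add: e_def)
    have "n \<le> m"
    proof (rule ccontr)
      assume "\<not> n \<le> m"
      then have "(nat m + Suc e, nat m) \<in> c" using nm e by (intro memd') auto
      then have "(nat m + e, nat m) \<in> c" by (rule down) auto
      from meme[OF this] show False using nm e by auto
    qed
    moreover have "m \<le> n + 1"
    proof (rule ccontr)
      assume "\<not> m \<le> n + 1"
      then have "(Suc (nat n) + e, Suc (nat n)) \<in> c" using nm e by (intro meme') auto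
      then have "(nat n + Suc e, nat n) \<in> c" by (rule down) auto
      from memd[OF this] show False using nm e by auto
    qed
    ultimately show ?thesis using False by (auto simp: bead_of_def n_def m_def)
  qed
qed

text \<open>
  Closure of the diagram under one step up or to the left is exactly the pair of inequalities
  between neighbouring diagonal lengths that the bead condition expresses.
\<close>
lemma profile_partition:
  assumes "profile n"
  shows "is_partition (young_of n)"
  unfolding is_partition_def
proof (intro conjI allI impI)
  have pos: "0 \<le> n d" and bead: "bead_of n d = 0 \<or> bead_of n d = 1" for d
    using assms by (auto simp: profile_def)
  have "b \<in> (\<lambda>(d, k). diag_box d k) ` (SIGMA d : {d. n d \<noteq> 0}. {..<nat (n d)})"
    if "b \<in> young_of n" for b
  proof -
    obtain p q where b: "b = (p, q)" by (cases b)
    have "b = (\<lambda>(d, k). diag_box d k) (int q - int p, min p q)"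
      by (simp add: b diag_box_content)
    moreover have "(int q - int p, min p q) \<in> (SIGMA d : {d. n d \<noteq> 0}. {..<nat (n d)})"
      using that by (auto simp: b young_of_def)
    ultimately show ?thesis by (rule image_eqI)
  qed
  then have "young_of n \<subseteq> (\<lambda>(d, k). diag_box d k) ` (SIGMA d : {d. n d \<noteq> 0}. {..<nat (n d)})"
    by blast
  moreover have "finite (SIGMA d : {d. n d \<noteq> 0}. {..<nat (n d)})"
    using assms by (auto simp: profile_def)
  ultimately show "finite (young_of n)" using finite_surj by blast
  have up: "(p, q) \<in> young_of n" if "(Suc p, q) \<in> young_of n" for p q
    using that bead[of "int q - int p - 1"]
    by (auto simp: young_of_def bead_of_def algebra_simps min_def split: if_splits)
  have left: "(p, q) \<in> young_of n" if "(p, Suc q) \<in> young_of n" for p q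
    using that bead[of "int q - int p"]
    by (auto simp: young_of_def bead_of_def algebra_simps min_def split: if_splits)
  fix i j i' j'
  assume "(i, j) \<in> young_of n \<and> i' \<le> i \<and> j' \<le> j"
  then have "(i, j) \<in> young_of n" "i' \<le> i" "j' \<le> j" by auto
  from \<open>i' \<le> i\<close> this(1) have "(i', j) \<in> young_of n"
    by (induction rule: inc_induct) (auto intro: up)
  with \<open>j' \<le> j\<close> show "(i', j') \<in> young_of n"
    by (induction rule: inc_induct) (auto intro: left)
qed

abbreviation bead :: "diagram \<Rightarrow> int \<Rightarrow> int" where
  "bead c \<equiv> bead_of (diag_len c)"

lemma bead_cases: "is_partition c \<Longrightarrow> bead c d = 0 \<or> bead c d = 1"
  using partition_profile by (auto simp: profile_def)

lemma diag_len_Diff: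
  assumes "is_partition c" "b \<in> c"
  shows "diag_len (c - {b}) d = diag_len c d - (if d = box_content b then 1 else 0)"
proof -
  have "finite c" using assms by (simp add: is_partition_def)
  have "{x \<in> c - {b}. box_content x = d} = {x \<in> c. box_content x = d} - (if d = box_content b then {b} else {})"
    by auto
  moreover have "1 \<le> card {x \<in> c. box_content x = box_content b}"
    using card_mono[of "{x \<in> c. box_content x = box_content b}" "{b}"] \<open>finite c\<close> assms by simp
  ultimately show ?thesis
    using \<open>finite c\<close> assms by (auto simp: diag_len_def of_nat_diff card_Diff_singleton_if)
qed

lemma diag_len_insert:
  assumes "is_partition c" "b \<notin> c"
  shows "diag_len (insert b c) d = diag_len c d + (if d = box_content b then 1 else 0)"
proof -
  have "finite c" using assms by (simp add: is_partition_def)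
  have "{x \<in> insert b c. box_content x = d} = {x \<in> c. box_content x = d} \<union> (if d = box_content b then {b} else {})"
    by auto
  then show ?thesis
    using \<open>finite c\<close> assms by (auto simp: diag_len_def)
qed

text \<open>
  Removing a box of content \<open>d\<close> shortens the diagonal \<open>d\<close> by one, which lowers the bead value at
  \<open>d\<close> and raises the one at \<open>d - 1\<close>. The result is a partition if and only if the new values are
  still 0 or 1 and the box was the last of its diagonal: a bead moves from \<open>d\<close> to the gap \<open>d - 1\<close>.
\<close>
lemma removable_iff:
  assumes c: "is_partition c"
  defines "d \<equiv> \<lambda>p q. int q - int p"
  shows "(p, q) \<in> c \<and> is_partition (c - {(p, q)}) \<longleftrightarrow>
    bead c (d p q - 1) = 0 \<and> bead c (d p q) = 1 \<and> int (min p q) = diag_len c (d p q) - 1"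
proof
  assume *: "(p, q) \<in> c \<and> is_partition (c - {(p, q)})"
  then have "\<not> int (min p q) < diag_len c (d p q) - 1"
    using partition_mem_iff[of "c - {(p, q)}" p q] diag_len_Diff[OF c, of "(p, q)"]
    by (auto simp: box_content_def d_def)
  moreover have "int (min p q) < diag_len c (d p q)"
    using * partition_mem_iff[OF c] by (auto simp: d_def)
  moreover have "bead c (d p q - 1) = 0 \<and> bead c (d p q) = 1"
    using * bead_cases[OF c, of "d p q - 1"] bead_cases[OF c, of "d p q"]
      bead_cases[of "c - {(p, q)}" "d p q - 1"] bead_cases[of "c - {(p, q)}" "d p q"]
    by (auto simp: bead_of_def diag_len_Diff[OF c] box_content_def d_def split: if_splits)
  ultimately show "bead c (d p q - 1) = 0 \<and> bead c (d p q) = 1 \<and> int (min p q) = diag_len c (d p q) - 1"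
    by auto
next
  assume *: "bead c (d p q - 1) = 0 \<and> bead c (d p q) = 1 \<and> int (min p q) = diag_len c (d p q) - 1"
  define n where "n = (diag_len c)(d p q := diag_len c (d p q) - 1)"
  have "profile n"
    unfolding profile_def
  proof (intro conjI allI)
    have "{x. n x \<noteq> 0} \<subseteq> insert (d p q) {x. diag_len c x \<noteq> 0}" by (auto simp: n_def)
    then show "finite {x. n x \<noteq> 0}"
      using partition_profile[OF c] finite_subset by (auto simp: profile_def)
    show "0 \<le> n x" for x using * diag_len_nonneg[of c x] by (auto simp: n_def)
    fix x
    have "x = d p q - 1 \<or> x + 1 \<noteq> d p q" by auto
    then show "bead_of n x \<in> {0, 1}"
    proof
      assume "x = d p q - 1"
      with * show ?thesis by (auto simp: bead_of_def n_def split: if_splits)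
    next
      assume "x + 1 \<noteq> d p q"
      with * bead_cases[OF c, of x] show ?thesis
        by (auto simp: bead_of_def n_def split: if_splits)
    qed
  qed
  then have "is_partition (young_of n)" by (rule profile_partition)
  moreover have "young_of n = c - {(p, q)}"
  proof -
    have "(i, j) \<in> young_of n \<longleftrightarrow> (i, j) \<in> c \<and> (i, j) \<noteq> (p, q)" for i j
      using * by (auto simp: young_of_def n_def partition_mem_iff[OF c] d_def min_def split: if_splits)
    then show ?thesis by auto
  qed
  moreover have "(p, q) \<in> c" using * by (simp add: partition_mem_iff[OF c] d_def)
  ultimately show "(p, q) \<in> c \<and> is_partition (c - {(p, q)})" by simp
qed

text \<open>
  Dually, adding a box of content \<open>d\<close> moves a bead from \<open>d - 1\<close> to the gap \<open>d\<close>.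
\<close>
lemma addable_iff:
  assumes c: "is_partition c"
  defines "d \<equiv> \<lambda>p q. int q - int p"
  shows "(p, q) \<notin> c \<and> is_partition (insert (p, q) c) \<longleftrightarrow>
    bead c (d p q - 1) = 1 \<and> bead c (d p q) = 0 \<and> int (min p q) = diag_len c (d p q)"
proof
  assume *: "(p, q) \<notin> c \<and> is_partition (insert (p, q) c)"
  then have "int (min p q) < diag_len c (d p q) + 1"
    using partition_mem_iff[of "insert (p, q) c" p q] diag_len_insert[OF c, of "(p, q)"]
    by (auto simp: box_content_def d_def)
  moreover have "\<not> int (min p q) < diag_len c (d p q)"
    using * partition_mem_iff[OF c] by (auto simp: d_def)
  moreover have "bead c (d p q - 1) = 1 \<and> bead c (d p q) = 0"
    using * bead_cases[OF c, of "d p q - 1"] bead_cases[OF c, of "d p q"]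
      bead_cases[of "insert (p, q) c" "d p q - 1"] bead_cases[of "insert (p, q) c" "d p q"]
    by (auto simp: bead_of_def diag_len_insert[OF c] box_content_def d_def split: if_splits)
  ultimately show "bead c (d p q - 1) = 1 \<and> bead c (d p q) = 0 \<and> int (min p q) = diag_len c (d p q)"
    by auto
next
  assume *: "bead c (d p q - 1) = 1 \<and> bead c (d p q) = 0 \<and> int (min p q) = diag_len c (d p q)"
  define n where "n = (diag_len c)(d p q := diag_len c (d p q) + 1)"
  have "profile n"
    unfolding profile_def
  proof (intro conjI allI)
    have "{x. n x \<noteq> 0} \<subseteq> insert (d p q) {x. diag_len c x \<noteq> 0}" by (auto simp: n_def)
    then show "finite {x. n x \<noteq> 0}"
      using partition_profile[OF c] finite_subset by (auto simp: profile_def)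
    show "0 \<le> n x" for x using * diag_len_nonneg[of c x] by (auto simp: n_def)
    fix x
    have "x = d p q - 1 \<or> x + 1 \<noteq> d p q" by auto
    then show "bead_of n x \<in> {0, 1}"
    proof
      assume "x = d p q - 1"
      with * show ?thesis by (auto simp: bead_of_def n_def split: if_splits)
    next
      assume "x + 1 \<noteq> d p q"
      with * bead_cases[OF c, of x] show ?thesis
        by (auto simp: bead_of_def n_def split: if_splits)
    qed
  qed
  then have "is_partition (young_of n)" by (rule profile_partition)
  moreover have "young_of n = insert (p, q) c"
  proof -
    have "(i, j) \<in> young_of n \<longleftrightarrow> (i, j) \<in> c \<or> (i, j) = (p, q)" for i j
      using * by (auto simp: young_of_def n_def partition_mem_iff[OF c] d_def min_def split: if_splits)
    then show ?thesis by auto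
  qed
  moreover have "(p, q) \<notin> c" using * by (simp add: partition_mem_iff[OF c] d_def)
  ultimately show "(p, q) \<notin> c \<and> is_partition (insert (p, q) c)" by simp
qed

section \<open>Cores on the abacus\<close>

lemma residue_box_content: "residue b = of_int (box_content b)"
  by (simp add: residue_def box_content_def)

lemma of_int_eq_iff_mod6: "(of_int x :: 6) = of_int y \<longleftrightarrow> 6 dvd x - y"
  using of_int_eq_0_iff_char_dvd[of "x - y", where 'a = 6] by simp

text \<open>
  On an abacus with six runners, the beads of each runner are pushed down without gaps. All
  the combinatorics below uses cores in this form.
\<close>
definition abacus_core :: "diagram \<Rightarrow> bool" where
  "abacus_core c \<longleftrightarrow> is_partition c \<and> (\<forall>d. bead c (d + 6) \<le> bead c d)"

lemma abacus_core_partition: "abacus_core c \<Longrightarrow> is_partition c"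
  by (simp add: abacus_core_def)

lemma abacus_core_antimono:
  assumes "abacus_core c" "(of_int d :: 6) = of_int e" "d \<le> e"
  shows "bead c e \<le> bead c d"
proof -
  obtain k where k: "e - d = 6 * k" using assms(2)[symmetric] by (auto simp: of_int_eq_iff_mod6)
  have "bead c (d + 6 * int m) \<le> bead c d" for m
  proof (induction m)
    case (Suc m)
    have "bead c (d + 6 * int m + 6) \<le> bead c (d + 6 * int m)"
      using assms(1) by (simp add: abacus_core_def)
    with Suc show ?case by (simp add: algebra_simps)
  qed simp
  from this[of "nat k"] show ?thesis using k assms(3) by (simp add: algebra_simps split: if_splits)
qed

text \<open>
  A bead at \<open>x\<close> and a gap at \<open>z < x\<close> are the ends of a row and of a column that meet in a box of
  the diagram, and the hook of that box has length \<open>x - z\<close>. So a bead at \<open>z + 6\<close> above a gap at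
  \<open>z\<close> would produce a hook of length 6.
\<close>
lemma core6_abacus_core:
  assumes "c \<in> cores6"
  shows "abacus_core c"
  unfolding abacus_core_def
proof (intro conjI allI)
  show c: "is_partition c" using assms by (simp add: cores6_def)
  fix z :: int
  define x where "x = z + 6"
  show "bead c (z + 6) \<le> bead c z"
  proof (rule ccontr)
    assume "\<not> bead c (z + 6) \<le> bead c z"
    then have sx: "bead c x = 1" and sz: "bead c z = 0"
      using bead_cases[OF c, of x] bead_cases[OF c, of z] by (auto simp: x_def)
    \<comment> \<open>The row whose last box has content \<open>x\<close>, and the column whose last box has content \<open>z + 1\<close>;
      an empty row \<open>i\<close> counts as ending at content \<open>- i - 1\<close>, an empty column \<open>j\<close> at \<open>j + 1\<close>.\<close>
    define i where "i = nat (diag_len c (x + 1) + max 0 (- x - 1))"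
    define j where "j = nat (diag_len c z + max 0 z)"
    note nn = diag_len_nonneg[of c x] diag_len_nonneg[of c "x + 1"]
      diag_len_nonneg[of c z] diag_len_nonneg[of c "z + 1"]
    have down: "(p', q') \<in> c" if "(p, q) \<in> c" "p' \<le> p" "q' \<le> q" for p q p' q'
      using c that unfolding is_partition_def by blast
    have i: "int i = diag_len c (x + 1) + max 0 (- x - 1)" using nn by (simp add: i_def)
    have j: "int j = diag_len c z + max 0 z" using nn by (simp add: j_def)
    have row: "(i, q) \<in> c \<longleftrightarrow> int q \<le> int i + x" for q
    proof -
      have "(i, nat (int i + x)) \<in> c" if "0 \<le> int i + x"
      proof -
        have "int i < diag_len c x \<or> int i + x < diag_len c x"
          using i sx unfolding bead_of_def by (cases "x < 0"; simp)
        then show ?thesis using that by (auto simp: partition_mem_iff[OF c])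
      qed
      moreover have "0 \<le> int i + x + 1" using i nn by linarith
      moreover have "(i, nat (int i + x + 1)) \<notin> c"
      proof -
        have "diag_len c (x + 1) \<le> int i \<and> diag_len c (x + 1) \<le> int i + x + 1" using i by linarith
        then show ?thesis using \<open>0 \<le> int i + x + 1\<close> by (auto simp: partition_mem_iff[OF c] min_def algebra_simps)
      qed
      moreover have "nat (int i + x + 1) \<le> q" if "\<not> int q \<le> int i + x" using that by linarith
      ultimately show ?thesis using down[of i "nat (int i + x)" i q] down[of i q i "nat (int i + x + 1)"]
        by (cases "int q \<le> int i + x") auto
    qed
    have col: "(p, j) \<in> c \<longleftrightarrow> int p + z < int j" for p
    proof -
      have "(nat (int j - z - 1), j) \<in> c" if "0 \<le> int j - z - 1"
      proof -
        have "int j < diag_len c (z + 1) \<or> int j - z - 1 < diag_len c (z + 1)"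
          using j sz unfolding bead_of_def by (cases "z < 0"; simp)
        then show ?thesis using that by (auto simp: partition_mem_iff[OF c])
      qed
      moreover have "0 \<le> int j - z" using j nn by linarith
      moreover have "(nat (int j - z), j) \<notin> c"
      proof -
        have "diag_len c z \<le> int j \<and> diag_len c z \<le> int j - z" using j by linarith
        then show ?thesis using \<open>0 \<le> int j - z\<close> by (auto simp: partition_mem_iff[OF c] min_def)
      qed
      moreover have "nat (int j - z) \<le> p" if "\<not> int p + z < int j" using that by linarith
      ultimately show ?thesis using down[of "nat (int j - z - 1)" j p j] down[of p j "nat (int j - z)" j]
        by (cases "int p + z < int j") auto
    qed
    have ij: "(i, j) \<in> c"
    proof (rule ccontr)
      assume "(i, j) \<notin> c"
      with row[of j] col[of i] show False by (simp add: x_def)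
    qed
    \<comment> \<open>\<open>a\<close> is the length of row \<open>i\<close>, and \<open>b\<close> the length of column \<open>j\<close>.\<close>
    define a where "a = nat (int i + x + 1)"
    define b where "b = nat (int j - z)"
    have ab: "j < a" "i < b" "a + b = i + j + 7"
      using row[of j] col[of i] ij by (auto simp: a_def b_def x_def)
    have "hook c (i, j) = Pair i ` {j..<a} \<union> (\<lambda>p. (p, j)) ` {Suc i..<b}"
    proof -
      have "(i, q) \<in> c \<longleftrightarrow> q < a" for q using row[of q] ab by (auto simp: a_def)
      moreover have "(p, j) \<in> c \<longleftrightarrow> p < b" for p using col[of p] ab by (auto simp: b_def)
      moreover have "p = i \<or> Suc i \<le> p" if "i \<le> p" for p using that by auto
      ultimately show ?thesis unfolding hook_def using ab by fastforce
    qed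
    moreover have "card (Pair i ` {j..<a} \<union> (\<lambda>p. (p, j)) ` {Suc i..<b}) = (a - j) + (b - Suc i)"
      by (subst card_Un_disjoint) (auto simp: card_image inj_on_def)
    ultimately have "hook_length c (i, j) = 6" using ab by (simp add: hook_length_def)
    with ij assms show False by (auto simp: cores6_def)
  qed
qed

section \<open>Reflections of cores\<close>

text \<open>
  The simple reflection \<open>s\<^sub>i\<close> on diagonal lengths. It exchanges the bead values at \<open>d - 1\<close> and
  \<open>d\<close> for every \<open>d\<close> of residue \<open>i\<close> (lemma \<open>bead_reflect\<close>), whence it is an involution that
  preserves profiles.
\<close>
definition reflect :: "6 \<Rightarrow> (int \<Rightarrow> int) \<Rightarrow> int \<Rightarrow> int" where
  "reflect i n d = n d + (if of_int d = i then bead_of n (d - 1) - bead_of n d else 0)"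

lemma bead_diff: "bead_of n (d - 1) - bead_of n d
    = n (d - 1) - 2 * n d + n (d + 1) + (if d = 0 then 1 else 0)"
  by (auto simp: bead_of_def)

lemma bead_reflect: "bead_of (reflect i n) d =
    bead_of n (if of_int d = i then d - 1 else if of_int (d + 1) = i then d + 1 else d)"
  by (auto simp: bead_of_def reflect_def)

lemma reflect_reflect: "reflect i (reflect i n) = n"
proof
  fix d
  have "bead_of (reflect i n) (d - 1) = bead_of n d"
    "bead_of (reflect i n) d = bead_of n (d - 1)" if "of_int d = i"
    using that by (auto simp: bead_reflect)
  then show "reflect i (reflect i n) d = n d" by (simp add: reflect_def)
qed

lemma profile_reflect:
  assumes "profile n"
  shows "profile (reflect i n)"
  unfolding profile_def
proof (intro conjI allI)
  let ?S = "{d. n d \<noteq> 0}"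
  have "{d. reflect i n d \<noteq> 0} \<subseteq> ?S \<union> (\<lambda>d. d + 1) ` ?S \<union> (\<lambda>d. d - 1) ` ?S \<union> {0}"
  proof
    fix d assume "d \<in> {d. reflect i n d \<noteq> 0}"
    then have "n d \<noteq> 0 \<or> n (d - 1) \<noteq> 0 \<or> n (d + 1) \<noteq> 0 \<or> d = 0"
      by (auto simp: reflect_def bead_diff split: if_splits)
    moreover have "d = (d - 1) + 1" "d = (d + 1) - 1" by auto
    ultimately show "d \<in> ?S \<union> (\<lambda>d. d + 1) ` ?S \<union> (\<lambda>d. d - 1) ` ?S \<union> {0}" by blast
  qed
  moreover have "finite ?S" using assms by (simp add: profile_def)
  ultimately show "finite {d. reflect i n d \<noteq> 0}" using finite_subset by fastforce
  fix d
  have "0 \<le> n d" "0 \<le> n (d - 1)" "0 \<le> n (d + 1)"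
    "bead_of n d = 0 \<or> bead_of n d = 1" "bead_of n (d - 1) = 0 \<or> bead_of n (d - 1) = 1"
    using assms by (auto simp: profile_def)
  then show "0 \<le> reflect i n d" using bead_diff[of n d] by (auto simp: reflect_def)
  show "bead_of (reflect i n) d \<in> {0, 1}" using assms by (auto simp: bead_reflect profile_def)
qed

text \<open>
  In a core, a removable node of residue \<open>i\<close> excludes addable nodes of the same residue: the
  first is a bead on runner \<open>i\<close> with a gap before it on runner \<open>i - 1\<close>, the second is the opposite,
  and along both runners the beads come before the gaps. Hence exchanging all the pairs of positions
  \<open>(d - 1, d)\<close> with \<open>d\<close> of residue \<open>i\<close> only removes nodes or only adds nodes, as the core
  reflection does.
\<close>
lemma core_reflection_conv_reflect:
  assumes "abacus_core c"
  shows "core_reflection i c = young_of (reflect i (diag_len c))"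
proof -
  note c = abacus_core_partition[OF assms]
  let ?n = "diag_len c"
  have rem: "(p, q) \<in> removable_nodes c i \<longleftrightarrow> of_int (int q - int p) = i \<and>
      bead c (int q - int p - 1) = 0 \<and> bead c (int q - int p) = 1 \<and>
      int (min p q) = ?n (int q - int p) - 1" for p q
    using removable_iff[OF c, of p q]
    by (auto simp: removable_nodes_def residue_box_content box_content_def)
  have add: "(p, q) \<in> addable_nodes c i \<longleftrightarrow> of_int (int q - int p) = i \<and>
      bead c (int q - int p - 1) = 1 \<and> bead c (int q - int p) = 0 \<and>
      int (min p q) = ?n (int q - int p)" for p q
    using addable_iff[OF c, of p q]
    by (auto simp: addable_nodes_def residue_box_content box_content_def)
  have "(p, q) \<in> core_reflection i c \<longleftrightarrow> (p, q) \<in> young_of (reflect i ?n)" for p q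
  proof -
    define d where "d = int q - int p"
    note ed = bead_cases[OF c, of d] bead_cases[OF c, of "d - 1"]
    note at_pq = rem[of p q, folded d_def] add[of p q, folded d_def]
      partition_mem_iff[OF c, of p q, folded d_def]
    have young: "(p, q) \<in> young_of n \<longleftrightarrow> int (min p q) < n d" for n
      by (simp add: young_of_def d_def)
    show ?thesis
    proof (cases "removable_nodes c i = {}")
      case False
      then obtain p0 q0 where "(p0, q0) \<in> removable_nodes c i" by auto
      then obtain e where e: "of_int e = i" "bead c (e - 1) = 0" "bead c e = 1"
        unfolding rem by blast
      have "\<not> (bead c (d - 1) = 1 \<and> bead c d = 0)" if "of_int d = i"
      proof (cases "d \<le> e")
        case True
        with abacus_core_antimono[OF assms, of d e] e that show ?thesis by simp
      next
        case False
        with abacus_core_antimono[OF assms, of "e - 1" "d - 1"] e that show ?thesis by simp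
      qed
      then have "(p, q) \<in> c - removable_nodes c i \<longleftrightarrow> (p, q) \<in> young_of (reflect i ?n)"
        using ed unfolding Diff_iff at_pq young reflect_def
        by (cases "of_int d = i"; elim disjE; simp; linarith)
      with False show ?thesis by (simp add: core_reflection_def)
    next
      case True
      have "\<not> (bead c (d - 1) = 0 \<and> bead c d = 1)" if "of_int d = i"
      proof
        assume *: "bead c (d - 1) = 0 \<and> bead c d = 1"
        then have "0 < ?n d"
          using diag_len_nonneg[of c "d - 1"] diag_len_nonneg[of c "d + 1"]
          by (auto simp: bead_of_def split: if_splits)
        obtain p q where pq: "diag_box d (nat (?n d - 1)) = (p, q)" by (cases "diag_box d (nat (?n d - 1))")
        then have "int q - int p = d" "int (min p q) = ?n d - 1"
          using \<open>0 < ?n d\<close> by (auto simp: diag_box_def)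
        with * that have "(p, q) \<in> removable_nodes c i" by (simp add: rem)
        with True show False by simp
      qed
      then have "(p, q) \<in> c \<union> addable_nodes c i \<longleftrightarrow> (p, q) \<in> young_of (reflect i ?n)"
        using ed unfolding Un_iff at_pq young reflect_def
        by (cases "of_int d = i"; elim disjE; simp; linarith)
      with True show ?thesis by (simp add: core_reflection_def)
    qed
  qed
  then show ?thesis by auto
qed

lemma diag_len_core_reflection:
  assumes "abacus_core c"
  shows "diag_len (core_reflection i c) = reflect i (diag_len c)"
proof -
  have "profile (reflect i (diag_len c))"
    using assms by (intro profile_reflect partition_profile abacus_core_partition)
  then show ?thesis
    unfolding core_reflection_conv_reflect[OF assms]
    by (intro diag_len_young_of) (simp add: profile_def)
qed

lemma abacus_core_reflection:
  assumes "abacus_core c"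
  shows "abacus_core (core_reflection i c)"
  unfolding abacus_core_def
proof (intro conjI allI)
  have "profile (reflect i (diag_len c))"
    using assms by (intro profile_reflect partition_profile abacus_core_partition)
  then show "is_partition (core_reflection i c)"
    by (simp add: core_reflection_conv_reflect[OF assms] profile_partition)
  have six: "(of_int (d + 6) :: 6) = of_int d" for d
    unfolding of_int_eq_iff_mod6 by simp
  have le: "bead c (d + 6) \<le> bead c d" for d using assms by (simp add: abacus_core_def)
  show "bead (core_reflection i c) (d + 6) \<le> bead (core_reflection i c) d" for d
    using six[of d] six[of "d + 1"] le[of d] le[of "d + 1"] le[of "d - 1"]
    unfolding diag_len_core_reflection[OF assms] bead_reflect
    by (auto simp: algebra_simps)
qed

lemma core_reflection_involution:
  assumes "abacus_core c"
  shows "core_reflection i (core_reflection i c) = c"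
  using core_reflection_conv_reflect[OF abacus_core_reflection[OF assms], of i i]
    young_of_diag_len[OF abacus_core_partition[OF assms]]
  by (simp add: diag_len_core_reflection[OF assms] reflect_reflect)

lemma abacus_core_empty: "abacus_core {}"
  by (auto simp: abacus_core_def partition_empty bead_of_def diag_len_def)

section \<open>Numbers of nodes\<close>

definition counts :: "diagram \<Rightarrow> 6 \<Rightarrow> int" where
  "counts c i = int (num_nodes c i)"

text \<open>
  The pairing of the weight \<open>\<Lambda>\<^sub>0 - (\<Sum>j. a\<^sub>j \<alpha>\<^sub>j)\<close> with the \<open>i\<close>-th simple coroot.
\<close>
definition coroot_value :: "(6 \<Rightarrow> int) \<Rightarrow> 6 \<Rightarrow> int" where
  "coroot_value a i = (if i = 0 then 1 else 0) - 2 * a i + a (i - 1) + a (i + 1)"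

lemma counts_conv_sum:
  assumes "finite c" "finite T" "box_content ` c \<subseteq> T"
  shows "counts c i = (\<Sum>d\<in>T. if of_int d = i then diag_len c d else 0)"
proof -
  have "counts c i = (\<Sum>b\<in>nodes c i. 1)" by (simp add: counts_def num_nodes_def)
  also have "\<dots> = (\<Sum>d\<in>T. \<Sum>b\<in>{b \<in> nodes c i. box_content b = d}. 1)"
    using assms by (intro sum.group[symmetric]) (auto simp: nodes_def)
  also have "\<dots> = (\<Sum>d\<in>T. if of_int d = i then diag_len c d else 0)"
  proof (rule sum.cong)
    fix d
    have "{b \<in> nodes c i. box_content b = d}
        = (if of_int d = i then {b \<in> c. box_content b = d} else {})"
      by (auto simp: nodes_def residue_box_content)
    then show "(\<Sum>b\<in>{b \<in> nodes c i. box_content b = d}. 1)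
        = (if of_int d = i then diag_len c d else 0)"
      by (simp add: diag_len_def)
  qed simp
  finally show ?thesis .
qed

text \<open>
  The reflection changes the length of each diagonal \<open>d\<close> of residue \<open>i\<close> by a second difference
  of the diagonal lengths, plus 1 for \<open>d = 0\<close>; summing over these diagonals turns the lengths at
  \<open>d - 1\<close>, \<open>d\<close> and \<open>d + 1\<close> into the numbers of nodes of residue \<open>i - 1\<close>, \<open>i\<close> and \<open>i + 1\<close>.
\<close>
lemma counts_core_reflection:
  assumes "abacus_core c"
  shows "counts (core_reflection i c) = (counts c)(i := counts c i + coroot_value (counts c) i)"
proof
  fix j
  let ?n = "diag_len c" and ?c' = "core_reflection i c"
  \<comment> \<open>A finite set of diagonals that contains all the diagonals meeting either core together with
    their neighbours, so that the shifted sums lose no term.\<close>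
  define T0 where "T0 = box_content ` c \<union> box_content ` ?c' \<union> {0}"
  define T where "T = T0 \<union> (\<lambda>d. d + 1) ` T0 \<union> (\<lambda>d. d - 1) ` T0"
  have fin: "finite c" "finite ?c'"
    using abacus_core_partition[OF assms] abacus_core_partition[OF abacus_core_reflection[OF assms]]
    by (auto simp: is_partition_def)
  then have T: "finite T" "box_content ` c \<subseteq> T" "box_content ` ?c' \<subseteq> T" "0 \<in> T"
    by (auto simp: T_def T0_def)
  have T_pred: "box_content ` c \<subseteq> (\<lambda>d. d - 1) ` T"
  proof
    fix d assume "d \<in> box_content ` c"
    then have "d + 1 \<in> T" by (auto simp: T_def T0_def)
    then show "d \<in> (\<lambda>d. d - 1) ` T" by (metis add_diff_cancel_right' image_eqI)
  qed
  have T_succ: "box_content ` c \<subseteq> (\<lambda>d. d + 1) ` T"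
  proof
    fix d assume "d \<in> box_content ` c"
    then have "d - 1 \<in> T" by (auto simp: T_def T0_def)
    then show "d \<in> (\<lambda>d. d + 1) ` T" by (metis diff_add_cancel image_eqI)
  qed
  have same: "counts c k = (\<Sum>d\<in>T. if of_int d = k then ?n d else 0)" for k
    using T fin by (intro counts_conv_sum)
  have pred: "counts c (i - 1) = (\<Sum>d\<in>T. if of_int d = i then ?n (d - 1) else 0)"
    using T fin T_pred
    by (subst counts_conv_sum[where T = "(\<lambda>d. d - 1) ` T"])
      (auto simp: sum.reindex inj_on_def intro!: sum.cong)
  have succ: "counts c (i + 1) = (\<Sum>d\<in>T. if of_int d = i then ?n (d + 1) else 0)"
    using T fin T_succ
    by (subst counts_conv_sum[where T = "(\<lambda>d. d + 1) ` T"])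
      (auto simp: sum.reindex inj_on_def intro!: sum.cong)
  have zero: "(if i = 0 then 1 else 0) = (\<Sum>d\<in>T. if of_int d = i then (if d = 0 then 1 else 0) else (0::int))"
  proof -
    have "(\<Sum>d\<in>T. if of_int d = i then (if d = 0 then 1 else 0) else (0::int))
        = (\<Sum>d\<in>T. if d = 0 then (if i = 0 then 1 else 0) else 0)"
      by (rule sum.cong) auto
    then show ?thesis using T by simp
  qed
  have "coroot_value (counts c) i = (\<Sum>d\<in>T. if of_int d = i then bead c (d - 1) - bead c d else 0)"
    unfolding coroot_value_def pred succ zero same[of i] bead_diff sum_distrib_left
      sum_subtractf[symmetric] sum.distrib[symmetric]
    by (rule sum.cong) auto
  then show "counts ?c' j = ((counts c)(i := counts c i + coroot_value (counts c) i)) j"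
    unfolding counts_conv_sum[OF fin(2) T(1,3)] diag_len_core_reflection[OF assms] reflect_def
    using same[of j] by (auto simp: sum.distrib[symmetric] intro!: sum.cong)
qed

text \<open>
  A box with maximal sum of coordinates can be removed.
\<close>
lemma removable_box_exists:
  assumes "is_partition c" "c \<noteq> {}"
  shows "\<exists>i. removable_nodes c i \<noteq> {}"
proof -
  define f where "f = (\<lambda>(p, q). p + q :: nat)"
  have "finite c" using assms by (simp add: is_partition_def)
  define m where "m = Max (f ` c)"
  have "m \<in> f ` c" using \<open>finite c\<close> assms(2) by (simp add: m_def)
  then obtain p q where pq: "(p, q) \<in> c" "p + q = m" by (auto simp: f_def)
  have max: "i + j \<le> m" if "(i, j) \<in> c" for i j
  proof -
    have "f (i, j) \<le> m" unfolding m_def using that \<open>finite c\<close> by (intro Max_ge) auto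
    then show ?thesis by (simp add: f_def)
  qed
  have "is_partition (c - {(p, q)})"
    unfolding is_partition_def
  proof (intro conjI allI impI)
    show "finite (c - {(p, q)})" using \<open>finite c\<close> by simp
    fix i j i' j' assume *: "(i, j) \<in> c - {(p, q)} \<and> i' \<le> i \<and> j' \<le> j"
    then have "(i', j') \<in> c" using assms(1) unfolding is_partition_def by blast
    moreover have "(i', j') \<noteq> (p, q)" using * max[of i j] pq by auto
    ultimately show "(i', j') \<in> c - {(p, q)}" by simp
  qed
  with pq have "(p, q) \<in> removable_nodes c (residue (p, q))" by (simp add: removable_nodes_def)
  then show ?thesis by blast
qed

text \<open>
  A removable node has some residue \<open>i\<close>; the reflection \<open>s\<^sub>i\<close> then removes nodes, so it lowers
  the number of \<open>i\<close>-nodes, and the change is the coroot value. This drives every descent below.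
\<close>
lemma coroot_value_negative:
  assumes "abacus_core c" "c \<noteq> {}"
  shows "\<exists>i. coroot_value (counts c) i < 0"
proof -
  obtain i where i: "removable_nodes c i \<noteq> {}"
    using removable_box_exists[OF abacus_core_partition[OF assms(1)] assms(2)] by blast
  have "finite c" using abacus_core_partition[OF assms(1)] by (simp add: is_partition_def)
  have "nodes (core_reflection i c) i \<subset> nodes c i"
    using i by (auto simp: core_reflection_def nodes_def removable_nodes_def)
  then have "counts (core_reflection i c) i < counts c i"
    using \<open>finite c\<close> by (auto simp: counts_def num_nodes_def nodes_def intro!: psubset_card_mono)
  then show ?thesis unfolding counts_core_reflection[OF assms(1)] by auto
qed

lemma num_boxes_conv_counts:
  assumes "finite c"
  shows "int (num_boxes c) = (\<Sum>i\<in>UNIV. counts c i)"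
proof -
  have "card c = (\<Sum>b\<in>c. 1)" by simp
  also have "\<dots> = (\<Sum>i\<in>UNIV. \<Sum>b\<in>{b \<in> c. residue b = i}. 1)"
    using assms by (intro sum.group[symmetric]) auto
  finally show ?thesis by (simp add: num_boxes_def counts_def num_nodes_def nodes_def)
qed

text \<open>
  Two cores with the same numbers of nodes have the same coroot values. If they are nonempty, one
  reflection shrinks both, keeps the numbers of nodes equal, and can be undone.
\<close>
lemma counts_determine_core:
  assumes "abacus_core c" "abacus_core c'" "counts c = counts c'"
  shows "c = c'"
  using assms
proof (induction "num_boxes c" arbitrary: c c' rule: less_induct)
  case less
  have fin: "finite c" "finite c'"
    using less.prems by (auto simp: is_partition_def dest: abacus_core_partition)
  show ?case
  proof (cases "c = {}")
    case True
    have "int (num_boxes c') = int (num_boxes c)"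
      unfolding num_boxes_conv_counts[OF fin(1)] num_boxes_conv_counts[OF fin(2)] less.prems(3) ..
    with True fin show ?thesis by (simp add: num_boxes_def)
  next
    case False
    from coroot_value_negative[OF less.prems(1) False]
    obtain i where i: "coroot_value (counts c) i < 0" by blast
    let ?r = "core_reflection i"
    have fin': "finite (?r c)"
      using abacus_core_partition[OF abacus_core_reflection[OF less.prems(1)]] by (simp add: is_partition_def)
    have "int (num_boxes (?r c)) < int (num_boxes c)"
      unfolding num_boxes_conv_counts[OF fin'] num_boxes_conv_counts[OF fin(1)]
        counts_core_reflection[OF less.prems(1)]
      using i by (intro sum_strict_mono_ex1) auto
    then have "?r c = ?r c'"
      using less.prems by (intro less.hyps abacus_core_reflection) (auto simp: counts_core_reflection)
    then show ?thesis using core_reflection_involution less.prems by metis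
  qed
qed

section \<open>Displacements of the fundamental weight\<close>

lemma UNIV_6: "(UNIV :: 6 set) = {0, 1, 2, 3, 4, 5}"
proof -
  have "x \<in> {0, 1, 2, 3, 4, 5}" for x :: 6
  proof (cases x)
    case (of_int z)
    then have "z = 0 \<or> z = 1 \<or> z = 2 \<or> z = 3 \<or> z = 4 \<or> z = 5" by auto
    with of_int show ?thesis by auto
  qed
  then show ?thesis by auto
qed

lemma sum_6: "sum f (UNIV :: 6 set) = f 0 + f 1 + f 2 + f 3 + f 4 + f 5"
  unfolding UNIV_6 by (simp add: add.assoc)

lemma coroot_value_simps:
  "coroot_value a 0 = 1 - 2 * a 0 + a 5 + a 1"
  "coroot_value a 1 = a 0 + a 2 - 2 * a 1"
  "coroot_value a 2 = a 1 + a 3 - 2 * a 2"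
  "coroot_value a 3 = a 2 + a 4 - 2 * a 3"
  "coroot_value a 4 = a 3 + a 5 - 2 * a 4"
  "coroot_value a 5 = a 4 + a 0 - 2 * a 5"
proof -
  have "a (-1) = a 5" "a 6 = a 0" by (rule arg_cong[of _ _ a]; simp)+
  then show "coroot_value a 0 = 1 - 2 * a 0 + a 5 + a 1"
    "coroot_value a 1 = a 0 + a 2 - 2 * a 1"
    "coroot_value a 2 = a 1 + a 3 - 2 * a 2"
    "coroot_value a 3 = a 2 + a 4 - 2 * a 3"
    "coroot_value a 4 = a 3 + a 5 - 2 * a 4"
    "coroot_value a 5 = a 4 + a 0 - 2 * a 5"
    by (simp_all add: coroot_value_def)
qed

definition root_sum :: "(6 \<Rightarrow> real) \<Rightarrow> weight" where
  "root_sum a = (\<Sum>j\<in>UNIV. a j *\<^sub>R simple_root j)"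

lemma fst_simple_root: "fst (simple_root j) $ i = cartan i j"
  by (simp add: simple_root_def)

lemma pairing_root_sum:
  "coroot_pairing (root_sum a) i = 2 * a i - a (i - 1) - a (i + 1)"
proof -
  have "cartan i j = (if j = i then 2 else 0) - (if j = i - 1 then 1 else 0) - (if j = i + 1 then 1 else 0)"
    for j
  proof -
    have "i - 1 \<noteq> i + 1"
    proof
      assume "i - 1 = i + 1"
      then have "i + 1 - (i - 1) = 0" by simp
      then show False by simp
    qed
    moreover have "i - 1 \<noteq> i" "i + 1 \<noteq> i" by auto
    moreover have "i = j + 1 \<longleftrightarrow> j = i - 1" by auto
    ultimately show ?thesis by (auto simp: cartan_def)
  qed
  then have "coroot_pairing (root_sum a) i = (\<Sum>j\<in>UNIV. a j *
      ((if j = i then 2 else 0) - (if j = i - 1 then 1 else 0) - (if j = i + 1 then 1 else 0)))"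
    by (simp add: coroot_pairing_def root_sum_def fst_sum fst_simple_root)
  also have "\<dots> = (\<Sum>j\<in>UNIV. (if j = i then 2 * a j else 0) - (if j = i - 1 then a j else 0)
      - (if j = i + 1 then a j else 0))"
    by (rule sum.cong) auto
  also have "\<dots> = 2 * a i - a (i - 1) - a (i + 1)" by (simp add: sum_subtractf)
  finally show ?thesis .
qed

lemma coroot_pairing_diff: "coroot_pairing (x - y) i = coroot_pairing x i - coroot_pairing y i"
  by (simp add: coroot_pairing_def)

lemma pairing_fundamental_weight:
  "coroot_pairing (fundamental_weight j) i = (if i = j then 1 else 0)"
  by (auto simp: coroot_pairing_def fundamental_weight_def axis_def)

lemma snd_root_sum: "snd (root_sum a) = a 0"
  by (simp add: root_sum_def snd_sum simple_root_def if_distrib cong: if_cong)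

text \<open>
  Let a difference of two sums vanish. Its \<open>\<delta>\<close>-component is the coefficient of \<open>\<alpha>\<^sub>0\<close>, and its
  coroot values say that the coefficients form a harmonic function on a cycle of length six. Such a
  function is constant, and here it has a zero.
\<close>
lemma root_sum_inject:
  assumes "root_sum a = root_sum b"
  shows "a = b"
proof -
  define f where "f i = a i - b i" for i
  have f0: "f 0 = 0" using snd_root_sum[of a] snd_root_sum[of b] assms by (simp add: f_def)
  have rel: "2 * f i = f (i - 1) + f (i + 1)" for i
    using pairing_root_sum[of a i] pairing_root_sum[of b i] assms by (simp add: f_def)
  have "f (-1) = f 5" "f 6 = f 0" by (rule arg_cong[of _ _ f]; simp)+
  with rel[of 0] rel[of 1] rel[of 2] rel[of 3] rel[of 4] rel[of 5] f0
  have "f i = 0" if "i \<in> {0, 1, 2, 3, 4, 5}" for i using that by auto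
  then have "f i = 0" for i using UNIV_6 by blast
  then show ?thesis by (auto simp: f_def)
qed

lemma root_sum_scale: "k *\<^sub>R root_sum a = root_sum (\<lambda>i. k * a i)"
  by (simp add: root_sum_def scaleR_sum_right)

abbreviation act_weight :: "6 list \<Rightarrow> weight \<Rightarrow> weight" where
  "act_weight \<equiv> foldr weight_reflection"

abbreviation act_core :: "6 list \<Rightarrow> diagram \<Rightarrow> diagram" where
  "act_core \<equiv> foldr core_reflection"

lemma abacus_core_act: "abacus_core c \<Longrightarrow> abacus_core (act_core u c)"
  by (induction u) (auto intro: abacus_core_reflection)

lemma act_core_rev:
  assumes "abacus_core c"
  shows "act_core (rev u) (act_core u c) = c"
  using assms
  by (induction u) (auto simp: core_reflection_involution abacus_core_act)

text \<open>
  The dictionary between cores and weights: the action of a word on the core and on the weight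
  change the coefficient of \<open>\<alpha>\<^sub>i\<close> by the same coroot value.
\<close>
lemma weight_displacement:
  "fundamental_weight 0 - act_weight u (fundamental_weight 0)
     = root_sum (\<lambda>i. real_of_int (counts (act_core u {}) i))"
proof (induction u)
  case Nil
  show ?case by (simp add: root_sum_def counts_def num_nodes_def nodes_def)
next
  case (Cons i u)
  define a where "a = counts (act_core u {})"
  let ?x = "act_weight u (fundamental_weight 0)"
  have x: "?x = fundamental_weight 0 - root_sum (\<lambda>i. of_int (a i))"
    using Cons by (simp add: a_def algebra_simps)
  have "coroot_pairing ?x i = of_int (coroot_value a i)"
    using pairing_root_sum[of "\<lambda>i. of_int (a i)" i]
    unfolding x by (simp add: coroot_pairing_diff pairing_fundamental_weight coroot_value_def)
  moreover have "root_sum (\<lambda>j. of_int ((a(i := a i + t)) j))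
      = root_sum (\<lambda>j. of_int (a j)) + of_int t *\<^sub>R simple_root i" for t
  proof -
    have "root_sum (\<lambda>j. of_int ((a(i := a i + t)) j))
        = (\<Sum>j\<in>UNIV. of_int (a j) *\<^sub>R simple_root j + (if j = i then of_int t *\<^sub>R simple_root i else 0))"
      unfolding root_sum_def by (rule sum.cong) (auto simp: scaleR_add_left)
    then show ?thesis by (simp add: sum.distrib root_sum_def)
  qed
  moreover have "counts (act_core (i # u) {}) = a(i := a i + coroot_value a i)"
    using counts_core_reflection[OF abacus_core_act[OF abacus_core_empty]] by (simp add: a_def)
  moreover have "act_weight (i # u) (fundamental_weight 0) = ?x - coroot_pairing ?x i *\<^sub>R simple_root i"
    using weight_reflection_def[of i ?x] by simp
  ultimately have "fundamental_weight 0 - act_weight (i # u) (fundamental_weight 0)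
      = fundamental_weight 0 - ?x + of_int (coroot_value a i) *\<^sub>R simple_root i"
    and "root_sum (\<lambda>j. of_int (counts (act_core (i # u) {}) j))
      = root_sum (\<lambda>j. of_int (a j)) + of_int (coroot_value a i) *\<^sub>R simple_root i"
    by (simp_all only: diff_diff_eq2 diff_add_eq)
  then show ?case unfolding x by simp
qed

lemma act_core_cong:
  assumes "act_weight u (fundamental_weight 0) = act_weight v (fundamental_weight 0)"
  shows "act_core u {} = act_core v {}"
proof -
  have "(\<lambda>i. real_of_int (counts (act_core u {}) i)) = (\<lambda>i. real_of_int (counts (act_core v {}) i))"
    by (rule root_sum_inject) (simp only: assms flip: weight_displacement)
  then have "counts (act_core u {}) = counts (act_core v {})" by (auto simp: fun_eq_iff)
  then show ?thesis by (intro counts_determine_core abacus_core_act abacus_core_empty)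
qed

text \<open>
  By the dictionary, the weight \<open>w \<Lambda>\<^sub>0\<close> determines the numbers of nodes of \<open>w \<cdot> \<emptyset>\<close> and therefore
  the core, whatever word represents \<open>w\<close>.
\<close>
lemma weyl_act_word: "weyl_act (act_weight u) {} = act_core u {}"
  unfolding weyl_act_def
proof (rule the_equality)
  fix d assume "\<exists>v. act_weight u = act_weight v \<and> d = act_core v {}"
  then obtain v where "act_weight u = act_weight v" and d: "d = act_core v {}" by blast
  from act_core_cong[OF fun_cong[OF this(1)]] d show "d = act_core u {}" by (rule sym[OF trans[OF _ sym]])
qed blast

section \<open>The Weyl groups as groups of words\<close>

lemma linear_weight_reflection: "linear (weight_reflection i)"
  by (rule linearI)
    (simp_all add: weight_reflection_def coroot_pairing_def algebra_simps scaleR_add_left)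

lemma linear_act_weight: "linear (act_weight u)"
proof (induction u)
  case Nil
  show ?case using linear_id by (simp add: id_def)
next
  case (Cons i u)
  then show ?case using linear_compose[OF Cons linear_weight_reflection] by (simp add: comp_def)
qed

lemma weight_reflection_involution: "weight_reflection i (weight_reflection i x) = x"
  by (simp add: weight_reflection_def coroot_pairing_def fst_simple_root cartan_def)

lemma act_weight_rev: "act_weight (rev u) (act_weight u x) = x"
  by (induction u arbitrary: x) (auto simp: weight_reflection_involution)

lemma Bij_act_weight: "act_weight u \<in> Bij UNIV"
proof -
  have "bij (act_weight u)"
    using act_weight_rev[of u] act_weight_rev[of "rev u"] by (intro o_bij[of "act_weight (rev u)"]) auto
  then show ?thesis by (simp add: Bij_def)
qed

lemma inv_act_weight: "inv\<^bsub>BijGroup UNIV\<^esub> (act_weight u) = act_weight (rev u)"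
proof (rule group.inv_equality[OF group_BijGroup])
  show "act_weight (rev u) \<otimes>\<^bsub>BijGroup UNIV\<^esub> act_weight u = \<one>\<^bsub>BijGroup UNIV\<^esub>"
    using Bij_act_weight[of u] Bij_act_weight[of "rev u"]
    by (auto simp: BijGroup_def compose_def act_weight_rev)
qed (auto simp: BijGroup_def Bij_act_weight)

lemma mult_act_weight:
  "act_weight u \<otimes>\<^bsub>BijGroup UNIV\<^esub> act_weight v = act_weight (u @ v)"
  using Bij_act_weight[of u] Bij_act_weight[of v] by (auto simp: BijGroup_def compose_def)

lemma one_act_weight: "\<one>\<^bsub>BijGroup UNIV\<^esub> = act_weight []"
  by (auto simp: BijGroup_def)

lemma generated_by_words:
  assumes "w \<in> generated_by S" "S \<subseteq> range act_weight"
  shows "w \<in> range act_weight"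
  using assms(1)
proof induction
  case one
  show ?case unfolding one_act_weight by (rule rangeI)
next
  case (incl h)
  then show ?case using assms(2) by auto
next
  case (inv h)
  then obtain u where "h = act_weight u" using assms(2) by auto
  then show ?case by (simp add: inv_act_weight)
next
  case (eng h1 h2)
  then obtain u v where "h1 = act_weight u" "h2 = act_weight v" by auto
  then show ?case by (simp only: mult_act_weight) (rule rangeI)
qed

lemma generators_A52:
  "{s 0 \<circ> s 1 \<circ> s 5 \<circ> s 0, s 1 \<circ> s 5, s 2 \<circ> s 4, s 3}
    = act_weight ` {[0, 1, 5, 0], [1, 5], [2, 4], [3]}"
  by (simp add: comp_assoc)

lemma generators_G21:
  "{s 0 \<circ> s 1 \<circ> s 5 \<circ> s 0, s 2 \<circ> s 4, s 1 \<circ> s 3 \<circ> s 5}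
    = act_weight ` {[0, 1, 5, 0], [2, 4], [1, 3, 5]}"
  by (simp add: comp_assoc)

lemma weyl_group_A52_words: "w \<in> weyl_group_A52 \<Longrightarrow> w \<in> range act_weight"
  unfolding weyl_group_A52_def generators_A52
  by (erule generated_by_words) (rule image_mono, rule subset_UNIV)

lemma weyl_group_G21_words: "w \<in> weyl_group_G21 \<Longrightarrow> w \<in> range act_weight"
  unfolding weyl_group_G21_def generators_G21
  by (erule generated_by_words) (rule image_mono, rule subset_UNIV)

text \<open>
  Because \<open>s\<^sub>1 s\<^sub>3 s\<^sub>5 = (s\<^sub>1 s\<^sub>5) s\<^sub>3\<close>, an element that reaches a core in type
  \<open>G\<^sub>2\<^sup>(\<^sup>1\<^sup>)\<close> also serves as a witness in type \<open>A\<^sub>5\<^sup>(\<^sup>2\<^sup>)\<close>.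
\<close>
lemma weyl_group_G21_subset_A52: "weyl_group_G21 \<subseteq> weyl_group_A52"
proof
  fix w assume "w \<in> weyl_group_G21"
  then show "w \<in> weyl_group_A52"
    unfolding weyl_group_G21_def
  proof induction
    case one
    show ?case unfolding weyl_group_A52_def by (rule generate.one)
  next
    case (eng h1 h2)
    then show ?case unfolding weyl_group_A52_def by (intro generate.eng)
  next
    let ?G = "{s 0 \<circ> s 1 \<circ> s 5 \<circ> s 0, s 1 \<circ> s 5, s 2 \<circ> s 4, s 3}"
    have s35: "s 3 (s 5 x) = s 5 (s 3 x)" for x
      by (simp add: weight_reflection_def coroot_pairing_def fst_simple_root cartan_def algebra_simps)
    have "s 1 \<circ> s 3 \<circ> s 5 = act_weight [1, 5] \<otimes>\<^bsub>BijGroup UNIV\<^esub> act_weight [3]"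
      unfolding mult_act_weight by (auto simp: s35)
    moreover have "\<dots> \<in> generated_by ?G"
      by (intro generate.eng generate.incl) (simp_all add: comp_def)
    ultimately have s135: "s 1 \<circ> s 3 \<circ> s 5 \<in> generated_by ?G" by simp
    have "s 0 \<circ> s 1 \<circ> s 5 \<circ> s 0 \<in> generated_by ?G" "s 2 \<circ> s 4 \<in> generated_by ?G"
      by (auto intro: generate.incl)
    with s135 have gens: "g \<in> generated_by ?G"
      if "g \<in> {s 0 \<circ> s 1 \<circ> s 5 \<circ> s 0, s 2 \<circ> s 4, s 1 \<circ> s 3 \<circ> s 5}" for g using that by auto
    {
      case (incl h)
      then show ?case unfolding weyl_group_A52_def by (rule gens)
    next
      case (inv h)
      have "?G \<subseteq> carrier (BijGroup UNIV)"
        using Bij_act_weight unfolding generators_A52 by (auto simp: BijGroup_def simp del: foldr.simps)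
      then show ?case unfolding weyl_group_A52_def
        using group.generate_m_inv_closed[OF group_BijGroup _ gens[OF inv]] by simp
    }
  qed
qed

section \<open>Descent for cores of type \<open>G\<^sub>2\<^sup>(\<^sup>1\<^sup>)\<close>\<close>

text \<open>
  What the shape of the vector \<open>\<beta>\<close> of a core in \<open>cores6g\<close> says about its numbers of nodes.
\<close>
definition g2_symmetric :: "(6 \<Rightarrow> int) \<Rightarrow> bool" where
  "g2_symmetric a \<longleftrightarrow> a 5 = a 1 \<and> a 4 = a 2 \<and> a 3 = 2 * a 1 - a 0"

lemma cores6g_symmetric:
  assumes "c \<in> cores6g"
  shows "abacus_core c" "g2_symmetric (counts c)"
  using assms core6_abacus_core
  by (auto simp: cores6g_def beta_def counts_def g2_symmetric_def)

text \<open>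
  Let \<open>k\<^sub>i\<close> be the coroot values of a symmetric core. Symmetry gives \<open>k\<^sub>5 = k\<^sub>1\<close>, \<open>k\<^sub>4 = k\<^sub>2\<close>,
  \<open>k\<^sub>3 = 2 k\<^sub>1\<close>, and the level of \<open>\<Lambda>\<^sub>0\<close> gives \<open>k\<^sub>0 + 4 k\<^sub>1 + 2 k\<^sub>2 = 1\<close>. The generators
  \<open>s\<^sub>1 s\<^sub>3 s\<^sub>5\<close>, \<open>s\<^sub>2 s\<^sub>4\<close> and \<open>s\<^sub>0 s\<^sub>1 s\<^sub>5 s\<^sub>0\<close> preserve the symmetry and lower the number
  of boxes if \<open>k\<^sub>1\<close>, \<open>k\<^sub>2\<close> or \<open>k\<^sub>0 + k\<^sub>1\<close>, respectively, is negative. If none of the three is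
  negative while the core is nonempty, then \<open>k\<^sub>0 < 0\<close>, hence \<open>k\<^sub>1 > 0\<close>, and
  \<open>1 = (k\<^sub>0 + k\<^sub>1) + 3 k\<^sub>1 + 2 k\<^sub>2 \<ge> 3\<close>, which is absurd. So every nonempty symmetric core
  descends, and undoing the descent reaches it from the empty core.
\<close>
lemma symmetric_core_reachable:
  assumes "abacus_core c" "g2_symmetric (counts c)"
  shows "\<exists>u. act_weight u \<in> weyl_group_G21 \<and> act_core u {} = c"
  using assms
proof (induction "num_boxes c" arbitrary: c rule: less_induct)
  case less
  show ?case
  proof (cases "c = {}")
    case True
    have "act_weight [] \<in> weyl_group_G21"
      unfolding weyl_group_G21_def one_act_weight[symmetric] by (rule generate.one)
    then show ?thesis using True by (intro exI[of _ "[]"]) simp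
  next
    case False
    define a where "a = counts c"
    have a: "a 5 = a 1" "a 4 = a 2" "a 3 = 2 * a 1 - a 0"
      using less.prems(2) by (auto simp: g2_symmetric_def a_def)
    \<comment> \<open>\<open>v\<close> is a generator spelled backwards, so that undoing it applies the generator itself.\<close>
    have descend: ?thesis
      if v: "rev v \<in> {[0, 1, 5, 0], [2, 4], [1, 3, 5]}"
        and sym: "g2_symmetric (counts (act_core v c))"
        and lt: "(\<Sum>i\<in>UNIV. counts (act_core v c) i) < (\<Sum>i\<in>UNIV. counts c i)" for v
    proof -
      have core: "abacus_core (act_core v c)" using less.prems(1) by (rule abacus_core_act)
      have "int (num_boxes (act_core v c)) < int (num_boxes c)"
        using lt core less.prems(1) abacus_core_partition
        by (subst (1 2) num_boxes_conv_counts) (auto simp: is_partition_def)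
      with less.hyps[OF _ core sym] obtain u
        where u: "act_weight u \<in> weyl_group_G21" "act_core u {} = act_core v c" by auto
      have "act_weight (rev v) \<in> weyl_group_G21"
        unfolding weyl_group_G21_def generators_G21 using v by (intro generate.incl imageI)
      with u(1) have "act_weight (rev v @ u) \<in> weyl_group_G21"
        unfolding weyl_group_G21_def mult_act_weight[symmetric] by (intro generate.eng)
      moreover have "act_core (rev v @ u) {} = c"
        using u(2) act_core_rev[OF less.prems(1), of v] by simp
      ultimately show ?thesis by blast
    qed
    have step: "counts (act_core (i # w) c)
        = (counts (act_core w c))(i := counts (act_core w c) i + coroot_value (counts (act_core w c)) i)"
      for i w
      using counts_core_reflection[OF abacus_core_act[OF less.prems(1)]] by simp
    have base: "counts (act_core [] c) = a" by (simp add: a_def)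
    note evaluate = step base coroot_value_simps sum_6 g2_symmetric_def a
    obtain i where "coroot_value a i < 0"
      using coroot_value_negative[OF less.prems(1) False] by (auto simp: a_def)
    moreover have "i \<in> {0, 1, 2, 3, 4, 5}" using UNIV_6 by blast
    ultimately have "coroot_value a 1 < 0 \<or> coroot_value a 2 < 0 \<or>
        coroot_value a 0 + coroot_value a 1 < 0"
      using a by (auto simp: coroot_value_simps)
    then show ?thesis
    proof (elim disjE)
      assume *: "coroot_value a 1 < 0"
      show ?thesis
        by (rule descend[of "[5, 3, 1]"]) (use * in \<open>simp_all add: evaluate del: foldr.simps flip: a_def\<close>)
    next
      assume *: "coroot_value a 2 < 0"
      show ?thesis
        by (rule descend[of "[4, 2]"]) (use * in \<open>simp_all add: evaluate del: foldr.simps flip: a_def\<close>)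
    next
      assume *: "coroot_value a 0 + coroot_value a 1 < 0"
      show ?thesis
        by (rule descend[of "[0, 5, 1, 0]"]) (use * in \<open>simp_all add: evaluate del: foldr.simps flip: a_def\<close>)
    qed
  qed
qed

section \<open>Coefficients of the roots\<close>

text \<open>
  It suffices to know one element of the group that reaches the core: every other one has the same
  displacement, by the dictionary, and independence of the roots makes the coefficients unique.
\<close>
lemma root_coeffs_eqI:
  fixes \<alpha> :: "'i::finite \<Rightarrow> weight"
  assumes words: "\<And>w. w \<in> W \<Longrightarrow> w \<in> range act_weight"
    and inj: "\<And>x y. (\<Sum>i\<in>UNIV. x i *\<^sub>R \<alpha> i) = (\<Sum>i\<in>UNIV. y i *\<^sub>R \<alpha> i) \<Longrightarrow> x = y"
    and reach: "act_weight u \<in> W" "act_core u {} = c"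
    and x: "(\<Sum>i\<in>UNIV. x i *\<^sub>R \<alpha> i) = root_sum (\<lambda>i. k * real (num_nodes c i))"
  shows "root_coeffs \<alpha> (k *\<^sub>R fundamental_weight 0) W c = x"
proof -
  have disp: "k *\<^sub>R fundamental_weight 0 - act_weight v (k *\<^sub>R fundamental_weight 0)
      = root_sum (\<lambda>i. k * real (num_nodes (act_core v {}) i))" for v
  proof -
    have "k *\<^sub>R fundamental_weight 0 - act_weight v (k *\<^sub>R fundamental_weight 0)
        = k *\<^sub>R (fundamental_weight 0 - act_weight v (fundamental_weight 0))"
      by (simp add: linear_scale[OF linear_act_weight] scaleR_right_diff_distrib)
    then show ?thesis by (simp add: weight_displacement root_sum_scale counts_def)
  qed
  show ?thesis
    unfolding root_coeffs_def
  proof (rule the_equality)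
    show "\<exists>w\<in>W. weyl_act w {} = c \<and>
        k *\<^sub>R fundamental_weight 0 - w (k *\<^sub>R fundamental_weight 0) = (\<Sum>i\<in>UNIV. x i *\<^sub>R \<alpha> i)"
      using reach by (intro bexI[of _ "act_weight u"]) (simp_all add: weyl_act_word disp x)
  next
    fix y
    assume "\<exists>w\<in>W. weyl_act w {} = c \<and>
        k *\<^sub>R fundamental_weight 0 - w (k *\<^sub>R fundamental_weight 0) = (\<Sum>i\<in>UNIV. y i *\<^sub>R \<alpha> i)"
    then obtain w where w: "w \<in> W" "weyl_act w {} = c"
      "k *\<^sub>R fundamental_weight 0 - w (k *\<^sub>R fundamental_weight 0) = (\<Sum>i\<in>UNIV. y i *\<^sub>R \<alpha> i)"
      by blast
    from words[OF w(1)] obtain v where v: "w = act_weight v" by blast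
    have "(\<Sum>i\<in>UNIV. y i *\<^sub>R \<alpha> i) = root_sum (\<lambda>i. k * real (num_nodes c i))"
      using w(2,3) disp[of v] by (simp add: v weyl_act_word)
    with x show "y = x" by (intro inj) simp
  qed
qed

lemma root_sum_6: "root_sum a = a 0 *\<^sub>R simple_root 0 + a 1 *\<^sub>R simple_root 1 + a 2 *\<^sub>R simple_root 2
    + a 3 *\<^sub>R simple_root 3 + a 4 *\<^sub>R simple_root 4 + a 5 *\<^sub>R simple_root 5"
  by (simp add: root_sum_def sum_6)

definition on_residues :: "real \<Rightarrow> real \<Rightarrow> real \<Rightarrow> real \<Rightarrow> real \<Rightarrow> real \<Rightarrow> 6 \<Rightarrow> real" where
  "on_residues x0 x1 x2 x3 x4 x5 i =
     (if i = 0 then x0 else if i = 1 then x1 else if i = 2 then x2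
      else if i = 3 then x3 else if i = 4 then x4 else x5)"

lemma on_residues_simps:
  "on_residues x0 x1 x2 x3 x4 x5 0 = x0" "on_residues x0 x1 x2 x3 x4 x5 1 = x1"
  "on_residues x0 x1 x2 x3 x4 x5 2 = x2" "on_residues x0 x1 x2 x3 x4 x5 3 = x3"
  "on_residues x0 x1 x2 x3 x4 x5 4 = x4" "on_residues x0 x1 x2 x3 x4 x5 5 = x5"
  by (simp_all add: on_residues_def)

lemma on_residues_eqI:
  assumes "f 0 = x0" "f 1 = x1" "f 2 = x2" "f 3 = x3" "f 4 = x4" "f 5 = x5"
  shows "on_residues x0 x1 x2 x3 x4 x5 = f"
proof
  fix i :: 6
  have "i \<in> {0, 1, 2, 3, 4, 5}" using UNIV_6 by blast
  then show "on_residues x0 x1 x2 x3 x4 x5 i = f i"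
    using assms by (auto simp: on_residues_simps)
qed

text \<open>
  Folding a combination of the roots of type \<open>A\<^sub>5\<^sup>(\<^sup>2\<^sup>)\<close> or \<open>G\<^sub>2\<^sup>(\<^sup>1\<^sup>)\<close> back to the simple roots of
  type \<open>A\<^sub>5\<^sup>(\<^sup>1\<^sup>)\<close>, where linear independence is available and the coefficients are numbers of
  nodes.
\<close>
lemma A52_sum:
  "(\<Sum>i\<in>UNIV. x i *\<^sub>R simple_root_A52 i)
     = root_sum (on_residues (2 * x 0) (x 0 + x 1) (x 2) (2 * x 3) (x 2) (x 0 + x 1))"
proof -
  have "x 4 *\<^sub>R simple_root_A52 4 = x 0 *\<^sub>R simple_root_A52 0"
    by (rule arg_cong[of _ _ "\<lambda>i. x i *\<^sub>R simple_root_A52 i"]) simp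
  then have "(\<Sum>i\<in>UNIV. x i *\<^sub>R simple_root_A52 i) = x 0 *\<^sub>R simple_root_A52 0
      + x 1 *\<^sub>R simple_root_A52 1 + x 2 *\<^sub>R simple_root_A52 2 + x 3 *\<^sub>R simple_root_A52 3"
    unfolding sum_4 by (simp add: algebra_simps)
  then show ?thesis
    by (simp add: root_sum_6 on_residues_simps simple_root_A52_def algebra_simps)
qed

lemma G21_sum:
  "(\<Sum>i\<in>UNIV. x i *\<^sub>R simple_root_G21 i)
     = root_sum (on_residues (6 * x 0) (3 * x 0 + x 2) (3 * x 1) (2 * x 2) (3 * x 1) (3 * x 0 + x 2))"
proof -
  have "x 3 *\<^sub>R simple_root_G21 3 = x 0 *\<^sub>R simple_root_G21 0"
    by (rule arg_cong[of _ _ "\<lambda>i. x i *\<^sub>R simple_root_G21 i"]) simp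
  then have "(\<Sum>i\<in>UNIV. x i *\<^sub>R simple_root_G21 i) = x 0 *\<^sub>R simple_root_G21 0
      + x 1 *\<^sub>R simple_root_G21 1 + x 2 *\<^sub>R simple_root_G21 2"
    unfolding sum_3 by (simp add: algebra_simps)
  then show ?thesis
    by (simp add: root_sum_6 on_residues_simps simple_root_G21_def simple_root_A52_def algebra_simps)
qed

lemma A52_sum_inject:
  assumes "(\<Sum>i\<in>UNIV. x i *\<^sub>R simple_root_A52 i) = (\<Sum>i\<in>UNIV. y i *\<^sub>R simple_root_A52 i)"
  shows "x = y"
proof
  fix i :: 4
  note eq = fun_cong[OF root_sum_inject[OF assms[unfolded A52_sum]]]
  have "x 0 = y 0" "x 2 = y 2" "x 3 = y 3"
    using eq[of 0] eq[of 2] eq[of 3] by (simp_all add: on_residues_simps)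
  moreover from this have "x 1 = y 1" using eq[of 1] by (simp add: on_residues_simps)
  moreover have "i = 0 \<or> i = 1 \<or> i = 2 \<or> i = 3" using exhaust_4[of i] by auto
  ultimately show "x i = y i" by metis
qed

lemma G21_sum_inject:
  assumes "(\<Sum>i\<in>UNIV. x i *\<^sub>R simple_root_G21 i) = (\<Sum>i\<in>UNIV. y i *\<^sub>R simple_root_G21 i)"
  shows "x = y"
proof
  fix i :: 3
  note eq = fun_cong[OF root_sum_inject[OF assms[unfolded G21_sum]]]
  have "x 0 = y 0" "x 1 = y 1"
    using eq[of 0] eq[of 2] by (simp_all add: on_residues_simps)
  moreover from this have "x 2 = y 2" using eq[of 1] by (simp add: on_residues_simps)
  moreover have "i = 0 \<or> i = 1 \<or> i = 2" using exhaust_3[of i] by auto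
  ultimately show "x i = y i" by metis
qed

theorem proposition5p16:
  fixes c :: diagram
  assumes "c \<in> cores6g"
  shows "atomic_length_G21 c = atomic_length_A52 c + coeff_A52 c 3
       \<and> atomic_length_A52 c + coeff_A52 c 3
           = 1 / 2 * (real (num_boxes c) - real (num_nodes c 0) + real (num_nodes c 3))"
proof -
  define a where "a i = real (num_nodes c i)" for i
  note core = cores6g_symmetric[OF assms]
  have "real_of_int (counts c 5) = real_of_int (counts c 1)"
    "real_of_int (counts c 4) = real_of_int (counts c 2)"
    "real_of_int (counts c 3) = real_of_int (2 * counts c 1 - counts c 0)"
    using core(2) unfolding g2_symmetric_def by simp_all
  then have a: "a 5 = a 1" "a 4 = a 2" "a 3 = 2 * a 1 - a 0" by (simp_all add: counts_def a_def)
  obtain u where u: "act_weight u \<in> weyl_group_G21" "act_core u {} = c"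
    using symmetric_core_reachable[OF core] by blast
  then have u': "act_weight u \<in> weyl_group_A52" using weyl_group_G21_subset_A52 by blast
  \<comment> \<open>The solutions of the linear systems that compare \<open>A52_sum\<close> with the numbers of nodes, and
    \<open>G21_sum\<close> with three times these numbers; they use \<open>a 1 - a 0 / 2 = a 3 / 2\<close>.\<close>
  define x :: "4 \<Rightarrow> real" where
    "x i = (if i = 0 then a 0 / 2 else if i = 1 then a 3 / 2 else if i = 2 then a 2 else a 3 / 2)" for i
  define y :: "3 \<Rightarrow> real" where
    "y i = (if i = 0 then a 0 / 2 else if i = 1 then a 2 else 3 * a 3 / 2)" for i
  have "root_coeffs simple_root_A52 (1 *\<^sub>R fundamental_weight 0) weyl_group_A52 c = x"
  proof (rule root_coeffs_eqI[OF weyl_group_A52_words A52_sum_inject u' u(2)])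
    show "(\<Sum>i\<in>UNIV. x i *\<^sub>R simple_root_A52 i) = root_sum (\<lambda>i. 1 * real (num_nodes c i))"
      unfolding A52_sum a_def[symmetric]
      by (intro arg_cong[of _ _ root_sum] on_residues_eqI) (simp_all add: x_def a field_simps)
  qed
  then have x: "coeff_A52 c = x" by (simp add: coeff_A52_def Lambda0_A52_def)
  have "root_coeffs simple_root_G21 (3 *\<^sub>R fundamental_weight 0) weyl_group_G21 c = y"
  proof (rule root_coeffs_eqI[OF weyl_group_G21_words G21_sum_inject u])
    show "(\<Sum>i\<in>UNIV. y i *\<^sub>R simple_root_G21 i) = root_sum (\<lambda>i. 3 * real (num_nodes c i))"
      unfolding G21_sum a_def[symmetric]
      by (intro arg_cong[of _ _ root_sum] on_residues_eqI) (simp_all add: y_def a field_simps)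
  qed
  then have y: "coeff_G21 c = y" by (simp add: coeff_G21_def Lambda0_G21_def Lambda0_A52_def)
  have "finite c" using abacus_core_partition[OF core(1)] by (simp add: is_partition_def)
  then have "real_of_int (int (num_boxes c)) = (\<Sum>i\<in>UNIV. a i)"
    unfolding num_boxes_conv_counts[OF \<open>finite c\<close>] by (simp add: counts_def a_def)
  then have boxes: "real (num_boxes c) = a 0 + a 1 + a 2 + a 3 + a 4 + a 5" by (simp add: sum_6)
  \<comment> \<open>The index 0 appears as the literal 4 in \<open>sum_4\<close> and as the literal 3 in \<open>sum_3\<close>.\<close>
  have "atomic_length_A52 c = a 0 / 2 + a 3 + a 2" "atomic_length_G21 c = a 0 / 2 + a 2 + 3 * a 3 / 2"
    by (simp_all add: atomic_length_A52_def atomic_length_G21_def sum_4 sum_3 x y x_def y_def)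
  moreover have "coeff_A52 c 3 = a 3 / 2" by (simp add: x x_def)
  ultimately show ?thesis
    using a boxes unfolding a_def[symmetric] by (simp add: field_simps)
qed

end
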